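(* Let $p$ be a prime number and let $n,k$ be integers with $k\geq 1$ and $n\geq pk$. Then $$\chi\left(KG^p{{[n]}\choose k}_{ 2\text{-stab}}^{\sim}\right)\geq \left\lceil\frac{n-(k-1)p}{p-1}\right\rceil.$$
   Context: For a positive integer $a$, $[a]=\{1,\ldots,a\}$. For integers $n,k,s$, let $V(n,k,s)$ be the set of $k$-element subsets $S\subseteq[n]$ such that $|i-j|\geq s$ for all distinct $i,j\in S$. The almost $s$-stable Kneser hypergraph $KG^r{{[n]}\choose k}_{ s\text{-stab}}^{\sim}$ is the $r$-uniform hypergraph with vertex set $V(n,k,s)$ whose edges are the sets $\{S_1,\ldots,S_r\}$ of $r$ pairwise disjoint elements of $V(n,k,s)$. A proper coloring with $t$ colors of a hypergraph is a map from its vertex set to $[t]$ such that no edge is monochromatic; $\chi$ denotes the chromatic number, the smallest such $t$. *)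

theory Defs
  imports Complex_Main "HOL-Library.FuncSet" "HOL-Library.Disjoint_Sets"
    "HOL-Computational_Algebra.Primes"
begin

record 'a hypergraph =
  vertices :: "'a set"
  edges :: "'a set set"

definition monochromatic :: "('a \<Rightarrow> nat) \<Rightarrow> 'a set \<Rightarrow> bool" where
  "monochromatic c e \<longleftrightarrow> (\<exists>a. \<forall>v\<in>e. c v = a)"

definition proper_coloring :: "'a hypergraph \<Rightarrow> nat \<Rightarrow> ('a \<Rightarrow> nat) \<Rightarrow> bool" where
  "proper_coloring H t c \<longleftrightarrow>
     c \<in> vertices H \<rightarrow> {1..t} \<and> (\<forall>e\<in>edges H. \<not> monochromatic c e)"

text \<open>The value is unspecified if \<open>H\<close> has no proper coloring with finitely many colors.
  Lemma \<open>proper_coloring_exists\<close> below excludes this case for the almost stable Kneser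
  hypergraphs with \<open>r \<ge> 2\<close>.\<close>

definition chromatic_number :: "'a hypergraph \<Rightarrow> nat" where
  "chromatic_number H = (LEAST t. \<exists>c. proper_coloring H t c)"

definition almost_stable_sets :: "nat \<Rightarrow> nat \<Rightarrow> nat \<Rightarrow> nat set set" where
  "almost_stable_sets n k s =
     {S. S \<subseteq> {1..n} \<and> card S = k \<and>
         (\<forall>i\<in>S. \<forall>j\<in>S. i \<noteq> j \<longrightarrow> \<bar>int i - int j\<bar> \<ge> int s)}"

definition almost_stable_kneser_hypergraph ::
    "nat \<Rightarrow> nat \<Rightarrow> nat \<Rightarrow> nat \<Rightarrow> nat set hypergraph" where
  "almost_stable_kneser_hypergraph r n k s =
     \<lparr>vertices = almost_stable_sets n k s,
      edges = {e. e \<subseteq> almost_stable_sets n k s \<and> card e = r \<and> disjoint e}\<rparr>"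

lemma finite_almost_stable_sets: "finite (almost_stable_sets n k s)"
  by (rule finite_subset[of _ "Pow {1..n}"]) (auto simp: almost_stable_sets_def)

lemma proper_coloring_exists:
  assumes "r \<ge> 2"
  shows "\<exists>t c. proper_coloring (almost_stable_kneser_hypergraph r n k s) t c"
proof -
  let ?V = "almost_stable_sets n k s"
  obtain c where c: "bij_betw c ?V {1..card ?V}"
    using finite_same_card_bij[of ?V "{1..card ?V}"] finite_almost_stable_sets by auto
  have "\<not> monochromatic c e" if e: "e \<subseteq> ?V" "card e = r" for e
  proof
    assume "monochromatic c e"
    then obtain a where "\<forall>v\<in>e. c v = a"
      by (auto simp: monochromatic_def)
    then have "c ` e \<subseteq> {a}" by auto
    then have "card (c ` e) \<le> 1"
      using card_mono[of "{a}" "c ` e"] by simp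
    moreover have "card (c ` e) = r"
      using c e by (auto simp: bij_betw_def card_image inj_on_subset)
    ultimately show False using assms by simp
  qed
  then have "proper_coloring (almost_stable_kneser_hypergraph r n k s) (card ?V) c"
    using c by (auto simp: proper_coloring_def almost_stable_kneser_hypergraph_def bij_betw_def)
  then show ?thesis by blast
qed

end

theory Submission
  imports Defs "HOL-Library.Sublist" "HOL-Number_Theory.Cong"
begin

text \<open>A nonempty set \<open>X\<close> of pairs (position, value) with positions in \<open>{1..n}\<close>, values in
  \<open>\<int>\<^sub>p\<close> and at most one value per position is a signed vector. Given a proper coloring \<open>c\<close>,
  label \<open>X\<close> by the maximal length of an alternating subsequence and by its first value, if that
  length is at most \<open>p * (k - 1)\<close>. Otherwise some value occurs \<open>k\<close> times in an alternating
  subsequence, its positions contain a 2-stable \<open>k\<close>-set \<open>S\<close>, and \<open>X\<close> is labelled by \<open>c S\<close> and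
  the value. The \<open>\<int>\<^sub>p\<close>-Tucker lemma for this labelling is the claim.

  The Tucker lemma compares two complexes with a \<open>\<int>\<^sub>p\<close>-action. With \<open>g\<close> a generator, let
  \<open>A\<^sub>i\<close> be \<open>g - 1\<close> for even \<open>i\<close> and \<open>1 + g + \<dots> + g\<^sup>p\<^sup>-\<^sup>1\<close> for odd \<open>i\<close>. The join of
  \<open>n\<close> copies of \<open>\<int>\<^sub>p\<close> carries chains \<open>h\<^sub>0, \<dots>, h\<^sub>n\<^sub>-\<^sub>1\<close> with \<open>h\<^sub>0\<close> a vertex and
  \<open>\<partial>h\<^sub>i\<^sub>+\<^sub>1 = A\<^sub>i h\<^sub>i\<close>. The complex of the possible label sets is free, so the kernel of
  \<open>A\<^sub>i\<^sub>+\<^sub>1\<close> on its cochains mod \<open>p\<close> is the image of \<open>A\<^sub>i\<close>; this yields cocycles \<open>\<theta>\<^sub>i\<close> with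
  \<open>\<theta>\<^sub>0 = 1\<close>, \<open>\<theta>\<^sub>i = \<kappa>\<^sub>i A\<^sub>i\<close> and \<open>\<theta>\<^sub>i\<^sub>+\<^sub>1 = \<delta>\<kappa>\<^sub>i\<close>. By Stokes \<open>\<theta>\<^sub>i\<close> takes the value
  1 mod \<open>p\<close> on the image of \<open>h\<^sub>i\<close> under the labelling, for all \<open>i < n\<close>, so the label complex
  has a face with \<open>n\<close> vertices.\<close>

section \<open>Cochains on lists\<close>

text \<open>The simplicial coboundary on ordered tuples. The complex is augmented: the coboundary of
  the indicator of \<open>[]\<close> is 1 on every vertex.\<close>

fun cobd :: "('a list \<Rightarrow> int) \<Rightarrow> 'a list \<Rightarrow> int" where
  "cobd f [] = 0"
| "cobd f (v # x) = f x - cobd (\<lambda>y. f (v # y)) x"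

lemma cobd_diff: "cobd (\<lambda>x. f x - g x) x = cobd f x - cobd g x"
  by (induction x arbitrary: f g) auto

lemma cobd_zero [simp]: "cobd (\<lambda>x. 0) x = 0"
  by (induction x) auto

lemma cobd_sum: "cobd (\<lambda>x. \<Sum>j\<in>J. f j x) x = (\<Sum>j\<in>J. cobd (f j) x)"
  by (induction x arbitrary: f) (auto simp: sum_subtractf)

lemma cobd_map: "cobd (\<lambda>x. f (map h x)) x = cobd f (map h x)"
  by (induction x arbitrary: f) auto

lemma cobd_cobd: "cobd (cobd f) x = 0"
  by (induction x arbitrary: f) (auto simp: cobd_diff)

text \<open>Phrased with divisibility, so that one lemma serves congruences mod \<open>p\<close>
  and, with \<open>d = 0\<close>, equations.\<close>

lemma cobd_dvd:
  assumes "\<And>y. subseq y x \<Longrightarrow> Suc (length y) = length x \<Longrightarrow> d dvd f y"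
  shows "d dvd cobd f x"
  using assms
proof (induction x arbitrary: f)
  case (Cons v x)
  have "d dvd cobd (\<lambda>y. f (v # y)) x"
    by (rule Cons.IH) (rule Cons.prems, auto)
  moreover have "d dvd f x"
    by (rule Cons.prems) auto
  ultimately show ?case by simp
qed simp

section \<open>Alternating cochains\<close>

definition alternating :: "('a list \<Rightarrow> int) \<Rightarrow> bool" where
  "alternating f \<longleftrightarrow> (\<forall>u a b w. f (u @ a # b # w) = - f (u @ b # a # w))"

lemma alternatingD: "alternating f \<Longrightarrow> f (u @ a # b # w) = - f (u @ b # a # w)"
  unfolding alternating_def by blast

lemma alternating_Cons: "alternating f \<Longrightarrow> alternating (\<lambda>y. f (v # y))"
  unfolding alternating_def by (metis append_Cons)

lemma alternating_cobd:
  assumes "alternating f"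
  shows "alternating (cobd f)"
proof -
  have "cobd f (u @ a # b # w) = - cobd f (u @ b # a # w)" for u a b w
    using assms
  proof (induction u arbitrary: f)
    case Nil
    have "(\<lambda>y. f (b # a # y)) = (\<lambda>y. 0 - f (a # b # y))"
      using alternatingD[OF Nil, of "[]" b a] by auto
    then have "cobd (\<lambda>y. f (b # a # y)) w = - cobd (\<lambda>y. f (a # b # y)) w"
      by (simp add: cobd_diff del: diff_0)
    then show ?case by simp
  next
    case (Cons c u)
    show ?case
      using Cons.IH[OF alternating_Cons[OF Cons.prems, of c]] alternatingD[OF Cons.prems, of u a b w]
      by simp
  qed
  then show ?thesis unfolding alternating_def by blast
qed

text \<open>Adjacent swaps, which only change the sign, bring two equal entries side by side.
  Swapping these shows that the value is its own negative; it is an integer, hence 0 even when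
  \<open>p = 2\<close>.\<close>

lemma alternating_not_distinct:
  assumes "alternating f" "\<not> distinct z"
  shows "f z = 0"
proof -
  have move: "f (u @ y # v @ w) = 0 \<longleftrightarrow> f (u @ v @ y # w) = 0" for u v w y
  proof (induction v arbitrary: u)
    case (Cons c v)
    have "f (u @ y # (c # v) @ w) = - f ((u @ [c]) @ y # v @ w)"
      using alternatingD[OF assms(1), of u y c "v @ w"] by simp
    then show ?case using Cons.IH[of "u @ [c]"] by simp
  qed simp
  obtain xs ys zs y where z: "z = xs @ [y] @ ys @ [y] @ zs"
    using not_distinct_decomp[OF assms(2)] by blast
  have "f (xs @ ys @ y # y # zs) = 0"
    using alternatingD[OF assms(1), of "xs @ ys" y y zs] by simp
  then show ?thesis using move[of xs y ys "y # zs"] z by simp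
qed

section \<open>The action of the cyclic group\<close>

definition rot :: "nat \<Rightarrow> nat \<Rightarrow> 'a \<times> nat \<Rightarrow> 'a \<times> nat" where
  "rot p j = map_prod id (\<lambda>a. (a + j) mod p)"

lemma rot_Pair [simp]: "rot p j (i, a) = (i, (a + j) mod p)"
  by (simp add: rot_def)

lemma fst_rot [simp]: "fst (rot p j v) = fst v"
  by (cases v) simp

lemma rot_rot [simp]: "rot p j (rot p k v) = rot p (k + j) v"
  by (cases v) (simp add: mod_add_left_eq add.assoc)

lemma rot_comp [simp]: "rot p j \<circ> rot p k = rot p (k + j)"
  by (auto simp: fun_eq_iff)

lemma rot_mod: "rot p (j mod p) v = rot p j v"
  by (cases v) (simp add: mod_add_right_eq)

lemma rot_p [simp]: "rot p p = rot p 0"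
  by (auto simp: fun_eq_iff)

text \<open>The operators \<open>g - 1\<close> and \<open>1 + g + \<dots> + g\<^sup>p\<^sup>-\<^sup>1\<close> of the group ring, alternately;
  \<open>rot p 0\<close> only reduces the second components.\<close>

definition gop :: "nat \<Rightarrow> nat \<Rightarrow> (('a \<times> nat) list \<Rightarrow> int) \<Rightarrow> ('a \<times> nat) list \<Rightarrow> int" where
  "gop p i f x = (if even i then f (map (rot p 1) x) - f (map (rot p 0) x)
     else (\<Sum>j<p. f (map (rot p j) x)))"

lemma gop_diff: "gop p i (\<lambda>x. f x - g x) x = gop p i f x - gop p i g x"
  by (simp add: gop_def sum_subtractf)

lemma cobd_gop: "cobd (gop p i f) x = gop p i (cobd f) x"
proof (cases "even i")
  case True
  then have "gop p i f = (\<lambda>x. f (map (rot p 1) x) - f (map (rot p 0) x))"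
    by (simp add: gop_def fun_eq_iff)
  then show ?thesis using True
    by (simp add: cobd_diff cobd_map) (simp add: gop_def)
next
  case False
  then have "gop p i f = (\<lambda>x. \<Sum>j<p. f (map (rot p j) x))"
    by (simp add: gop_def fun_eq_iff)
  then show ?thesis using False
    by (simp add: cobd_sum cobd_map) (simp add: gop_def)
qed

text \<open>In the group ring, (g - 1)(1 + g + ... + g^(p-1)) = g^p - 1 = 0. Here the cyclic sum
  survives a shift because \<open>rot p p = rot p 0\<close>.\<close>

lemma gop_gop: "gop p i (gop p (Suc i) f) x = 0"
proof -
  have *: "(\<Sum>j<p. f (map (rot p (Suc j)) x)) = (\<Sum>j<p. f (map (rot p j) x))"
    using sum.lessThan_Suc_shift[of "\<lambda>j. f (map (rot p j) x)" p] by simp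
  show ?thesis
    by (cases "even i") (simp_all add: gop_def * sum_subtractf)
qed

lemma gop_dvd:
  assumes "\<And>j. d dvd f (map (rot p j) x)"
  shows "d dvd gop p i f x"
  using assms by (auto simp: gop_def intro!: dvd_diff dvd_sum)

text \<open>Evaluation on the chains \<open>h\<^sub>0 = a\<^sub>1\<close>, \<open>h\<^sub>i\<^sub>+\<^sub>1 = a\<^sub>i\<^sub>+\<^sub>2 * gop\<^sub>i h\<^sub>i\<close> of the join of copies
  of \<open>\<int>\<^sub>p\<close>, where \<open>a\<^sub>i\<close> is the unit element in the \<open>i\<close>-th copy.\<close>

fun heval :: "nat \<Rightarrow> nat \<Rightarrow> ((nat \<times> nat) list \<Rightarrow> int) \<Rightarrow> int" where
  "heval p 0 f = f [(1, 0)]"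
| "heval p (Suc i) f = heval p i (gop p i (\<lambda>x. f ((i + 2, 0) # x)))"

lemma heval_diff: "heval p i (\<lambda>x. f x - g x) = heval p i f - heval p i g"
proof (induction i arbitrary: f g)
  case (Suc i)
  have "gop p i (\<lambda>x. f ((i + 2, 0) # x) - g ((i + 2, 0) # x)) =
    (\<lambda>x. gop p i (\<lambda>x. f ((i + 2, 0) # x)) x - gop p i (\<lambda>x. g ((i + 2, 0) # x)) x)"
    by (rule ext) (rule gop_diff)
  then show ?case using Suc.IH by simp
qed simp

lemma heval_zero: "heval p i (\<lambda>x. 0) = 0"
  using heval_diff[of p i "\<lambda>x. 0" "\<lambda>x. 0"] by simp

text \<open>Stokes for the boundary relation of the chains. The boundary of a cone is its base minus
  the cone over the boundary of the base; by induction the latter contributes two consecutive group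
  ring operators, whose composite is 0.\<close>

lemma heval_cobd: "heval p (Suc i) (cobd f) = heval p i (gop p i f)"
proof (induction i arbitrary: f)
  case 0
  show ?case by (simp add: gop_def)
next
  case (Suc i)
  define g where "g = (\<lambda>y. f ((Suc i + 2, 0) # y))"
  have "heval p (Suc (Suc i)) (cobd f) = heval p (Suc i) (gop p (Suc i) (\<lambda>x. f x - cobd g x))"
    by (simp add: g_def)
  also have "gop p (Suc i) (\<lambda>x. f x - cobd g x) =
      (\<lambda>x. gop p (Suc i) f x - cobd (gop p (Suc i) g) x)"
    by (simp add: fun_eq_iff gop_diff cobd_gop)
  also have "heval p (Suc i) \<dots> =
      heval p (Suc i) (gop p (Suc i) f) - heval p (Suc i) (cobd (gop p (Suc i) g))"
    by (rule heval_diff)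
  also have "heval p (Suc i) (cobd (gop p (Suc i) g)) = heval p i (gop p i (gop p (Suc i) g))"
    by (rule Suc.IH)
  also have "\<dots> = 0"
    using heval_zero[of p i] by (simp add: gop_gop[abs_def])
  finally show ?case by simp
qed

definition signlist :: "nat \<Rightarrow> nat \<Rightarrow> (nat \<times> nat) list \<Rightarrow> bool" where
  "signlist p n x \<longleftrightarrow> distinct (map fst x) \<and> set x \<subseteq> {1..n} \<times> {..<p}"

lemma signlist_rot:
  "signlist p n x \<Longrightarrow> p > 0 \<Longrightarrow> signlist p n (map (rot p j) x)"
  by (auto simp: signlist_def comp_def)

lemma signlist_subseq: "signlist p n x \<Longrightarrow> subseq y x \<Longrightarrow> signlist p n y"
  unfolding signlist_def subseq_conv_nths
  by (metis distinct_nthsI nths_map set_nths_subset subset_trans)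

text \<open>The chain \<open>h\<^sub>i\<close> is carried by the lists that use each of the
  positions 1 to \<open>i + 1\<close> once.\<close>

lemma heval_dvd:
  assumes "p > 0"
    and "\<And>x. signlist p (Suc i) x \<Longrightarrow> length x = Suc i \<Longrightarrow> d dvd f x"
  shows "d dvd heval p i f"
  using assms(2)
proof (induction i arbitrary: f)
  case 0
  then show ?case using assms(1) by (simp add: signlist_def)
next
  case (Suc i)
  have "d dvd gop p i (\<lambda>x. f ((i + 2, 0) # x)) x"
    if x: "signlist p (Suc i) x" "length x = Suc i" for x
  proof (rule gop_dvd)
    fix j
    have "signlist p (Suc i) (map (rot p j) x)"
      using x assms(1) by (rule_tac signlist_rot)
    then have "signlist p (Suc (Suc i)) ((i + 2, 0) # map (rot p j) x)"
      using assms(1) by (fastforce simp: signlist_def)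
    then show "d dvd f ((i + 2, 0) # map (rot p j) x)"
      using Suc.prems x by simp
  qed
  then show ?case by (simp add: Suc.IH)
qed

text \<open>Evaluation of a cochain on the image, under the labelling, of the barycentric subdivision
  of the simplex \<open>x\<close>; the subdivision is the cone from the barycentre over the subdivided
  boundary.\<close>

fun seval :: "('a set \<Rightarrow> 'b) \<Rightarrow> nat \<Rightarrow> 'a list \<Rightarrow> ('b list \<Rightarrow> int) \<Rightarrow> int" where
  "seval lab 0 x f = f []"
| "seval lab (Suc r) x f = cobd (\<lambda>y. seval lab r y (\<lambda>z. f (lab (set x) # z))) x"

lemma seval_diff: "seval lab r x (\<lambda>z. f z - g z) = seval lab r x f - seval lab r x g"
  by (induction r arbitrary: x f g) (auto simp: cobd_diff)

lemma seval_sum: "seval lab r x (\<lambda>z. \<Sum>j\<in>J. f j z) = (\<Sum>j\<in>J. seval lab r x (f j))"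
  by (induction r arbitrary: x f) (auto simp: cobd_sum)

text \<open>Subdivision is a chain map: the boundary of the cone is its base, the subdivided
  boundary, minus a cone over the boundary of a boundary, which \<open>cobd_cobd\<close>
  kills.\<close>

lemma seval_cobd: "seval lab (Suc r) x (cobd f) = cobd (\<lambda>y. seval lab r y f) x"
proof (induction r arbitrary: x f)
  case 0
  show ?case by simp
next
  case (Suc r)
  let ?g = "\<lambda>z. f (lab (set x) # z)"
  have "seval lab (Suc (Suc r)) x (cobd f) =
      cobd (\<lambda>y. seval lab (Suc r) y f - seval lab (Suc r) y (cobd ?g)) x"
    by (subst seval.simps) (simp only: cobd.simps seval_diff)
  also have "\<dots> = cobd (\<lambda>y. seval lab (Suc r) y f) x - cobd (cobd (\<lambda>z. seval lab r z ?g)) x"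
    by (simp only: Suc.IH cobd_diff)
  finally show ?case by (simp only: cobd_cobd diff_0_right)
qed

lemma cobd_cong:
  assumes "\<And>y. subseq y x \<Longrightarrow> Suc (length y) = length x \<Longrightarrow> f y = g y"
  shows "cobd f x = cobd g x"
  using cobd_dvd[of x 0 "\<lambda>y. f y - g y"] assms by (simp add: cobd_diff)

lemma subseq_set: "subseq y x \<Longrightarrow> set y \<subseteq> set x"
  by (auto simp: subseq_conv_nths dest: in_set_nthsD)

text \<open>The subdivision of \<open>x\<close> is carried by the flags of nonempty subsets of
  \<open>set x\<close>; each cone puts its apex, the largest set, in front.\<close>

lemma seval_dvd:
  assumes "\<And>ys. length ys = r \<Longrightarrow> sorted_wrt (\<lambda>A B. B \<subseteq> A) ys \<Longrightarrow>
      (\<And>A. A \<in> set ys \<Longrightarrow> A \<noteq> {} \<and> A \<subseteq> set x) \<Longrightarrow> d dvd f (map lab ys)"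
    and "length x = r"
  shows "d dvd seval lab r x f"
  using assms
proof (induction r arbitrary: x f)
  case 0
  show ?case using "0.prems"(1)[of "[]"] by simp
next
  case (Suc r)
  have "d dvd seval lab r y (\<lambda>z. f (lab (set x) # z))"
    if y: "subseq y x" "Suc (length y) = length x" for y
  proof (rule Suc.IH)
    show "length y = r" using y Suc.prems by simp
    fix ys assume ys: "length ys = r" "sorted_wrt (\<lambda>A B. B \<subseteq> A) ys"
      "\<And>A. A \<in> set ys \<Longrightarrow> A \<noteq> {} \<and> A \<subseteq> set y"
    have "d dvd f (map lab (set x # ys))"
    proof (rule Suc.prems(1))
      show "length (set x # ys) = Suc r" using ys by simp
      show "sorted_wrt (\<lambda>A B. B \<subseteq> A) (set x # ys)"
        using ys(2,3) subseq_set[OF y(1)] by (simp) (meson subset_trans)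
      have "x \<noteq> []" using Suc.prems(2) by auto
      fix A assume "A \<in> set (set x # ys)"
      then show "A \<noteq> {} \<and> A \<subseteq> set x"
        using ys(3)[of A] subseq_set[OF y(1)] \<open>x \<noteq> []\<close> by auto
    qed
    then show "d dvd f (lab (set x) # map lab ys)" by simp
  qed
  then show ?case by (simp add: cobd_dvd)
qed

definition signset :: "nat \<Rightarrow> nat \<Rightarrow> (nat \<times> nat) set \<Rightarrow> bool" where
  "signset p n A \<longleftrightarrow> A \<noteq> {} \<and> A \<subseteq> {1..n} \<times> {..<p} \<and> inj_on fst A"

lemma signlist_signset: "signlist p n x \<Longrightarrow> A \<subseteq> set x \<Longrightarrow> A \<noteq> {} \<Longrightarrow> signset p n A"
  by (auto simp: signlist_def signset_def distinct_map intro: inj_on_subset)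

lemma rot_0_id: "snd v < p \<Longrightarrow> rot p 0 v = v"
  by (cases v) simp

lemma map_rot_0: "set x \<subseteq> B \<times> {..<p} \<Longrightarrow> map (rot p 0) x = x"
  by (rule map_idI) (auto intro!: rot_0_id)

lemma inj_on_shift: "inj_on (\<lambda>a. (a + j) mod p) {..<p::nat}"
proof (rule inj_onI)
  fix a b assume "a \<in> {..<p}" "b \<in> {..<p}" "(a + j) mod p = (b + j) mod p"
  then have "[a + j = b + j] (mod p)" by (simp add: cong_def)
  then have "[a = b] (mod p)" by (rule cong_add_rcancel_nat[THEN iffD1])
  then show "a = b" using \<open>a \<in> {..<p}\<close> \<open>b \<in> {..<p}\<close> by (auto simp: cong_def)
qed

section \<open>The \<open>\<int>\<^sub>p\<close>-Tucker lemma\<close>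

text \<open>An equivariant labelling of signed vectors. \<open>lab_low\<close> and
  \<open>lab_high\<close> ensure that the labels along a nonempty finite chain form a
  \<open>face\<close> in the sense below.\<close>

locale tucker_labelling =
  fixes p n \<alpha> t :: nat and lab :: "(nat \<times> nat) set \<Rightarrow> nat \<times> nat"
  assumes prime_p: "prime p"
    and lab_range: "signset p n A \<Longrightarrow> lab A \<in> {..<\<alpha> + t} \<times> {..<p}"
    and lab_rot: "signset p n A \<Longrightarrow> lab (rot p j ` A) = rot p j (lab A)"
    and lab_low: "signset p n A \<Longrightarrow> signset p n B \<Longrightarrow> A \<subseteq> B \<Longrightarrow>
      fst (lab A) = fst (lab B) \<Longrightarrow> fst (lab A) < \<alpha> \<Longrightarrow> lab A = lab B"
    and lab_high: "finite C \<Longrightarrow> (\<And>A. A \<in> C \<Longrightarrow> signset p n A) \<Longrightarrow>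
      (\<And>A B. A \<in> C \<Longrightarrow> B \<in> C \<Longrightarrow> A \<subseteq> B \<or> B \<subseteq> A) \<Longrightarrow> l \<ge> \<alpha> \<Longrightarrow>
      \<exists>a<p. (l, a) \<notin> lab ` C"
begin

lemma p_pos: "p > 0"
  using prime_p prime_gt_0_nat by blast

lemma seval_rot:
  assumes "signlist p n x" "length x = r"
  shows "seval lab r (map (rot p j) x) f = seval lab r x (\<lambda>z. f (map (rot p j) z))"
  using assms
proof (induction r arbitrary: x f)
  case (Suc r)
  have "signset p n (set x)"
    using Suc.prems by (intro signlist_signset[of p n x]) auto
  then have "lab (set (map (rot p j) x)) = rot p j (lab (set x))"
    by (simp add: lab_rot)
  then have "seval lab (Suc r) (map (rot p j) x) f =
      cobd (\<lambda>y. seval lab r (map (rot p j) y) (\<lambda>z. f (rot p j (lab (set x)) # z))) x"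
    by (simp only: seval.simps cobd_map[symmetric])
  also have "\<dots> = cobd (\<lambda>y. seval lab r y (\<lambda>z. f (map (rot p j) (lab (set x) # z)))) x"
    using Suc.prems by (intro cobd_cong) (auto simp: Suc.IH signlist_subseq)
  finally show ?case by simp
qed simp

lemma seval_gop:
  assumes "signlist p n x" "length x = r"
  shows "gop p i (\<lambda>y. seval lab r y f) x = seval lab r x (gop p i f)"
proof (cases "even i")
  case True
  then have "gop p i f = (\<lambda>x. f (map (rot p 1) x) - f (map (rot p 0) x))"
    by (simp add: gop_def fun_eq_iff)
  then show ?thesis using True
    by (simp add: seval_diff) (simp add: gop_def seval_rot assms)
next
  case False
  then have "gop p i f = (\<lambda>x. \<Sum>j<p. f (map (rot p j) x))"
    by (simp add: gop_def fun_eq_iff)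
  then show ?thesis using False
    by (simp add: seval_sum) (simp add: gop_def seval_rot assms)
qed

section \<open>The complex of label sets and its free action\<close>

definition level :: "(nat \<times> nat) set \<Rightarrow> nat \<Rightarrow> nat set" where
  "level \<sigma> l = {a. (l, a) \<in> \<sigma>}"

text \<open>The join of \<alpha> copies of the discrete space Z_p and \<open>t\<close> copies of the
  boundary of a simplex with \<open>p\<close> vertices.\<close>

definition face :: "(nat \<times> nat) set \<Rightarrow> bool" where
  "face \<sigma> \<longleftrightarrow> \<sigma> \<noteq> {} \<and> \<sigma> \<subseteq> {..<\<alpha> + t} \<times> {..<p} \<and>
     (\<forall>l. card (level \<sigma> l) < p \<and> (l < \<alpha> \<longrightarrow> card (level \<sigma> l) \<le> 1))"

lemma level_subset: "face \<sigma> \<Longrightarrow> level \<sigma> l \<subseteq> {..<p}"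
  by (auto simp: face_def level_def)

lemma finite_level: "face \<sigma> \<Longrightarrow> finite (level \<sigma> l)"
  using level_subset finite_subset by blast

lemma face_subset:
  assumes "face \<sigma>" "\<tau> \<subseteq> \<sigma>" "\<tau> \<noteq> {}"
  shows "face \<tau>"
proof -
  have "card (level \<tau> l) \<le> card (level \<sigma> l)" for l
    using assms by (intro card_mono finite_level) (auto simp: level_def)
  then have "card (level \<tau> l) < p \<and> (l < \<alpha> \<longrightarrow> card (level \<tau> l) \<le> 1)" for l
    using assms(1) unfolding face_def by (metis le_less_trans le_trans)
  then show ?thesis
    using assms unfolding face_def by blast
qed

text \<open>At most one vertex lies at each of the \<alpha> low levels and at most
  \<open>p - 1\<close> at each of the \<open>t\<close> high ones.\<close>

lemma card_face: "face \<sigma> \<Longrightarrow> card \<sigma> \<le> \<alpha> + t * (p - 1)"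
proof -
  assume \<sigma>: "face \<sigma>"
  have "\<sigma> = Sigma {..<\<alpha> + t} (level \<sigma>)"
    using \<sigma> by (auto simp: face_def level_def)
  then have "card \<sigma> = (\<Sum>l<\<alpha> + t. card (level \<sigma> l))"
    using card_SigmaI[of "{..<\<alpha> + t}" "level \<sigma>"] finite_level[OF \<sigma>] by simp
  also have "\<dots> = (\<Sum>l<\<alpha>. card (level \<sigma> l)) + (\<Sum>l<t. card (level \<sigma> (\<alpha> + l)))"
    by (induction t) auto
  also have "\<dots> \<le> (\<Sum>l<\<alpha>. 1) + (\<Sum>l<t. p - 1)"
  proof (intro add_mono sum_mono)
    fix l assume "l \<in> {..<\<alpha>}"
    then show "card (level \<sigma> l) \<le> 1" using \<sigma> by (auto simp: face_def)
  next
    fix l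
    have "card (level \<sigma> (\<alpha> + l)) < p" using \<sigma> by (auto simp: face_def)
    then show "card (level \<sigma> (\<alpha> + l)) \<le> p - 1" by simp
  qed
  finally show ?thesis by simp
qed

lemma level_rot: "level (rot p j ` \<sigma>) l = (\<lambda>a. (a + j) mod p) ` level \<sigma> l"
  by (force simp: level_def image_iff)

lemma card_level_rot: "face \<sigma> \<Longrightarrow> card (level (rot p j ` \<sigma>) l) = card (level \<sigma> l)"
  unfolding level_rot by (intro card_image inj_on_subset[OF inj_on_shift] level_subset)

lemma face_rot:
  assumes "face \<sigma>"
  shows "face (rot p j ` \<sigma>)"
proof -
  have "rot p j ` \<sigma> \<subseteq> {..<\<alpha> + t} \<times> {..<p}"
    using assms p_pos by (auto simp: face_def)
  then show ?thesis
    using assms card_level_rot[OF assms, of j] unfolding face_def by simp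
qed

text \<open>A proper nonempty subset \<open>S\<close> of \<open>\<int>\<^sub>p\<close> determines the residue \<open>\<Sum>S / card S\<close>, which moves
  by \<open>j\<close> when \<open>S\<close> is translated by \<open>j\<close>. This makes the action on the faces free, and
  the residue is a coordinate along the orbit.\<close>

definition bottom :: "(nat \<times> nat) set \<Rightarrow> nat set" where
  "bottom \<sigma> = level \<sigma> (LEAST l. level \<sigma> l \<noteq> {})"

definition orbit_index :: "(nat \<times> nat) set \<Rightarrow> nat" where
  "orbit_index \<sigma> = (SOME i. i < p \<and> [card (bottom \<sigma>) * i = \<Sum>(bottom \<sigma>)] (mod p))"

lemma coprime_card_bottom:
  assumes "face \<sigma>"
  shows "coprime (card (bottom \<sigma>)) p"
proof -
  have "\<exists>l. level \<sigma> l \<noteq> {}" using assms by (force simp: face_def level_def)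
  then have "bottom \<sigma> \<noteq> {}" unfolding bottom_def by (rule LeastI_ex)
  moreover have "finite (bottom \<sigma>)" unfolding bottom_def by (rule finite_level[OF assms])
  ultimately have "card (bottom \<sigma>) > 0" by (simp add: card_gt_0_iff)
  moreover have "card (bottom \<sigma>) < p" using assms unfolding bottom_def face_def by blast
  ultimately show ?thesis
    using prime_p by (metis coprime_commute nat_dvd_not_less prime_imp_coprime)
qed

lemma orbit_index:
  assumes "face \<sigma>"
  shows "orbit_index \<sigma> < p \<and> [card (bottom \<sigma>) * orbit_index \<sigma> = \<Sum>(bottom \<sigma>)] (mod p)"
proof -
  obtain i where "[card (bottom \<sigma>) * i = 1] (mod p)"
    using cong_solve_coprime_nat[OF coprime_card_bottom[OF assms]] by auto
  then have "[card (bottom \<sigma>) * i * \<Sum>(bottom \<sigma>) = 1 * \<Sum>(bottom \<sigma>)] (mod p)"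
    by (rule cong_scalar_right)
  moreover have "[card (bottom \<sigma>) * (i * \<Sum>(bottom \<sigma>) mod p) =
      card (bottom \<sigma>) * (i * \<Sum>(bottom \<sigma>))] (mod p)"
    by (intro cong_scalar_left) (simp add: cong_def)
  ultimately have "[card (bottom \<sigma>) * (i * \<Sum>(bottom \<sigma>) mod p) = \<Sum>(bottom \<sigma>)] (mod p)"
    using cong_trans by (simp add: mult.assoc) blast
  then have "\<exists>i. i < p \<and> [card (bottom \<sigma>) * i = \<Sum>(bottom \<sigma>)] (mod p)"
    using p_pos by (intro exI[of _ "i * \<Sum>(bottom \<sigma>) mod p"]) simp
  then show ?thesis unfolding orbit_index_def by (rule someI_ex)
qed

text \<open>Translation by \<open>j\<close> adds to the sum of the bottom level, mod
  \<open>p\<close>, its cardinality times \<open>j\<close>. The cardinality is a unit mod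
  \<open>p\<close> and cancels.\<close>

lemma orbit_index_rot:
  assumes "face \<sigma>"
  shows "orbit_index (rot p j ` \<sigma>) = (orbit_index \<sigma> + j) mod p"
proof -
  let ?S = "bottom \<sigma>" and ?T = "bottom (rot p j ` \<sigma>)"
  have T: "?T = (\<lambda>a. (a + j) mod p) ` ?S"
    by (simp add: bottom_def level_rot)
  have S: "?S \<subseteq> {..<p}" unfolding bottom_def by (rule level_subset[OF assms])
  note inj = inj_on_subset[OF inj_on_shift S]
  have card: "card ?T = card ?S" unfolding T by (rule card_image[OF inj])
  have "\<Sum>?T = (\<Sum>a\<in>?S. (a + j) mod p)"
    unfolding T by (simp add: sum.reindex[OF inj])
  moreover have "[(\<Sum>a\<in>?S. (a + j) mod p) = (\<Sum>a\<in>?S. a + j)] (mod p)"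
    by (intro cong_sum) (simp add: cong_def)
  moreover have "(\<Sum>a\<in>?S. a + j) = \<Sum>?S + card ?S * j"
    by (simp add: sum.distrib)
  moreover have "[card ?S * orbit_index \<sigma> + card ?S * j = \<Sum>?S + card ?S * j] (mod p)"
    using orbit_index[OF assms] by (simp add: cong_add_rcancel_nat)
  moreover have "[card ?T * orbit_index (rot p j ` \<sigma>) = \<Sum>?T] (mod p)"
    using orbit_index[OF face_rot[OF assms, of j]] by simp
  ultimately have "[card ?S * orbit_index (rot p j ` \<sigma>) = card ?S * (orbit_index \<sigma> + j)] (mod p)"
    unfolding card by (metis cong_sym cong_trans distrib_left)
  then have "[orbit_index (rot p j ` \<sigma>) = orbit_index \<sigma> + j] (mod p)"
    using coprime_card_bottom[OF assms] by (simp add: cong_mult_lcancel_nat)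
  then show ?thesis
    using orbit_index[OF face_rot[OF assms, of j]] by (simp add: cong_def)
qed

section \<open>Exactness of the group ring operators mod p\<close>

lemma face_map_rot_0: "face (set x) \<Longrightarrow> map (rot p 0) x = x"
  by (rule map_rot_0) (auto simp: face_def)

text \<open>An invariant cochain is a norm: \<open>f\<close> is constant mod \<open>p\<close> on
  each orbit, and \<open>g\<close> keeps its value only at the one element of index 0.\<close>

lemma alternating_divide_norm:
  assumes f: "alternating f"
    and inv: "\<And>x. face (set x) \<Longrightarrow> length x = r \<Longrightarrow>
      int p dvd f (map (rot p 1) x) - f (map (rot p 0) x)"
  defines "g \<equiv> \<lambda>x. if orbit_index (set x) = 0 then f x else 0"
  shows "alternating g"
    and "\<And>x. face (set x) \<Longrightarrow> length x = r \<Longrightarrow> int p dvd (\<Sum>j<p. g (map (rot p j) x)) - f x"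
proof -
  have "g (u @ a # b # w) = - g (u @ b # a # w)" for u a b w
    using alternatingD[OF f, of u a b w] by (simp add: g_def insert_commute)
  then show "alternating g" unfolding alternating_def by blast
  fix x assume x: "face (set x)" "length x = r"
  have f_rot: "int p dvd f (map (rot p j) x) - f x" for j
  proof (induction j)
    case 0
    then show ?case using x by (simp add: face_map_rot_0)
  next
    case (Suc j)
    have "int p dvd f (map (rot p (Suc j)) x) - f (map (rot p j) x)"
      using inv[of "map (rot p j) x"] x by (simp add: face_rot)
    with Suc show ?case by (metis diff_add_cancel dvd_add_right_iff add_diff_eq)
  qed
  \<comment> \<open>The shift that moves \<open>x\<close> to index 0; the outer \<open>mod p\<close>
    covers the case that the index is 0 already.\<close>
  define j where "j = (p - orbit_index (set x)) mod p"
  have lt: "orbit_index (set x) < p" using orbit_index[OF x(1)] by simp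
  have iff: "orbit_index (set (map (rot p i) x)) = 0 \<longleftrightarrow> i = j" if "i < p" for i
  proof -
    have "orbit_index (set (map (rot p i) x)) = (orbit_index (set x) + i) mod p"
      using orbit_index_rot[OF x(1)] by simp
    also have "\<dots> = 0 \<longleftrightarrow> i = j"
      using that lt by (cases "orbit_index (set x) = 0") (auto simp: j_def mod_if)
    finally show ?thesis .
  qed
  have "(\<Sum>i<p. g (map (rot p i) x)) = (\<Sum>i<p. if i = j then f (map (rot p i) x) else 0)"
    by (intro sum.cong) (auto simp: g_def iff[simplified])
  also have "\<dots> = f (map (rot p j) x)"
    using p_pos by (simp add: j_def)
  finally show "int p dvd (\<Sum>i<p. g (map (rot p i) x)) - f x"
    using f_rot by simp
qed

text \<open>The shift by \<open>p\<close> minus the index leads from \<open>x\<close> back to the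
  element of index 0. From there \<open>g\<close> sums \<open>f\<close> along the orbit, up to the
  element before \<open>x\<close>, so that its differences are the values of
  \<open>f\<close>.\<close>

lemma alternating_divide_diff:
  assumes f: "alternating f"
    and norm: "\<And>x. face (set x) \<Longrightarrow> length x = r \<Longrightarrow>
      int p dvd (\<Sum>j<p. f (map (rot p j) x))"
  defines "g \<equiv> \<lambda>x. \<Sum>j<orbit_index (set x). f (map (rot p (j + (p - orbit_index (set x)))) x)"
  shows "alternating g"
    and "\<And>x. face (set x) \<Longrightarrow> length x = r \<Longrightarrow>
      int p dvd g (map (rot p 1) x) - g (map (rot p 0) x) - f x"
proof -
  have "g (u @ a # b # w) = - g (u @ b # a # w)" for u a b w
  proof -
    have "f (map h (u @ a # b # w)) = - f (map h (u @ b # a # w))" for h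
      using alternatingD[OF f, of "map h u" "h a" "h b" "map h w"] by simp
    moreover have "set (u @ a # b # w) = set (u @ b # a # w)" by auto
    ultimately show ?thesis unfolding g_def by (simp only: sum_negf)
  qed
  then show "alternating g" unfolding alternating_def by blast
  fix x assume x: "face (set x)" "length x = r"
  let ?o = "orbit_index (set x)"
  have o: "?o < p" using orbit_index[OF x(1)] by simp
  have o1: "orbit_index (rot p 1 ` set x) = (?o + 1) mod p"
    by (rule orbit_index_rot[OF x(1)])
  show "int p dvd g (map (rot p 1) x) - g (map (rot p 0) x) - f x"
  proof (cases "?o + 1 < p")
    case True
    have "g (map (rot p 1) x) = (\<Sum>j<Suc ?o. f (map (rot p (j + (p - ?o))) x))"
      unfolding g_def using True o1 by (simp add: Suc_diff_Suc o)
    also have "\<dots> = g x + f x"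
      using o face_map_rot_0[OF x(1)] by (simp add: g_def)
    finally show ?thesis using face_map_rot_0[OF x(1)] by simp
  next
    \<comment> \<open>Here \<open>rot p 1\<close> wraps around to index 0, where the sum is empty;
      the sum over the whole orbit has to vanish mod \<open>p\<close>.\<close>
    case False
    then have p: "p = Suc ?o" using o by simp
    then have g1: "g (map (rot p 1) x) = 0"
      using o1 by (simp add: g_def)
    have p_o: "p - ?o = 1" using p by simp
    have "(\<Sum>j<Suc ?o. f (map (rot p j) x)) = f (map (rot p 0) x) + (\<Sum>j<?o. f (map (rot p (Suc j)) x))"
      by (rule sum.lessThan_Suc_shift)
    also have "\<dots> = f x + g x"
      using face_map_rot_0[OF x(1)] by (simp add: g_def p_o)
    finally have "int p dvd f x + g x" using norm[OF x] p by simp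
    moreover have "g (map (rot p 1) x) - g (map (rot p 0) x) - f x = - (f x + g x)"
      using g1 face_map_rot_0[OF x(1)] by simp
    ultimately show ?thesis by (simp only: dvd_minus_iff)
  qed
qed

lemma gop_exact:
  assumes "alternating f"
    and "\<And>x. face (set x) \<Longrightarrow> length x = r \<Longrightarrow> int p dvd gop p (Suc i) f x"
  obtains g where "alternating g"
    "\<And>x. face (set x) \<Longrightarrow> length x = r \<Longrightarrow> int p dvd gop p i g x - f x"
proof (cases "even i")
  case True
  show ?thesis
    using alternating_divide_diff[OF assms(1), of r] assms(2) True
    by (intro that) (auto simp: gop_def)
next
  case False
  show ?thesis
    using alternating_divide_norm[OF assms(1), of r] assms(2) False
    by (intro that) (auto simp: gop_def)
qed

section \<open>The labelling as a simplicial map\<close>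

lemma face_flag_labels:
  assumes "sorted_wrt (\<lambda>A B. B \<subseteq> A) ys" "ys \<noteq> []" "\<And>A. A \<in> set ys \<Longrightarrow> signset p n A"
  shows "face (set (map lab ys))"
proof -
  have chain: "A \<subseteq> B \<or> B \<subseteq> A" if "A \<in> set ys" "B \<in> set ys" for A B
  proof -
    obtain i where i: "i < length ys" "A = ys ! i" using \<open>A \<in> set ys\<close> by (auto simp: in_set_conv_nth)
    obtain j where j: "j < length ys" "B = ys ! j" using \<open>B \<in> set ys\<close> by (auto simp: in_set_conv_nth)
    show ?thesis
    proof (cases i j rule: linorder_cases)
      case less
      then show ?thesis using sorted_wrt_nth_less[OF assms(1) less j(1)] i(2) j(2) by simp
    next
      case greater
      then show ?thesis using sorted_wrt_nth_less[OF assms(1) greater i(1)] i(2) j(2) by simp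
    qed (simp add: i j)
  qed
  have range: "lab ` set ys \<subseteq> {..<\<alpha> + t} \<times> {..<p}"
    using lab_range assms(3) by blast
  have high: "card (level (lab ` set ys) l) < p" if "l \<ge> \<alpha>" for l
  proof -
    obtain a where "a < p" "(l, a) \<notin> lab ` set ys"
      using lab_high[of "set ys" l] assms(3) chain \<open>l \<ge> \<alpha>\<close> by blast
    moreover have "level (lab ` set ys) l \<subseteq> {..<p}"
      using range unfolding level_def by blast
    ultimately have "level (lab ` set ys) l \<subset> {..<p}"
      unfolding level_def by blast
    then have "card (level (lab ` set ys) l) < card {..<p}"
      by (rule psubset_card_mono[OF finite_lessThan])
    then show ?thesis by simp
  qed
  have low: "card (level (lab ` set ys) l) \<le> 1" if "l < \<alpha>" for l
  proof -
    have "a = b" if ab: "a \<in> level (lab ` set ys) l" "b \<in> level (lab ` set ys) l" for a b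
    proof -
      obtain A B where AB: "A \<in> set ys" "B \<in> set ys" "lab A = (l, a)" "lab B = (l, b)"
        using ab unfolding level_def image_iff mem_Collect_eq by metis
      have "lab A = lab B"
        using chain[OF AB(1,2)]
      proof
        assume "A \<subseteq> B"
        then show ?thesis
          using AB \<open>l < \<alpha>\<close> by (intro lab_low assms(3)) auto
      next
        assume "B \<subseteq> A"
        then show ?thesis
          using AB \<open>l < \<alpha>\<close> by (intro lab_low[symmetric] assms(3)) auto
      qed
      then show ?thesis using AB by simp
    qed
    moreover have "finite (level (lab ` set ys) l)"
      using range finite_subset[of "level (lab ` set ys) l" "{..<p}"] by (auto simp: level_def)
    ultimately show ?thesis by (simp add: card_le_Suc0_iff_eq)
  qed
  \<comment> \<open>\<open>face\<close> asks for \<open>card < p\<close> at low levels too, where it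
    comes from the bound 1.\<close>
  have "p > 1" using prime_p by (rule prime_gt_1_nat)
  show ?thesis
    unfolding face_def set_map
  proof (intro conjI allI impI)
    fix l
    show "card (level (lab ` set ys) l) < p"
      using high[of l] low[of l] \<open>p > 1\<close> by (cases "l < \<alpha>") auto
  qed (use assms(2) range low in auto)
qed

lemma seval_dvd_face:
  assumes "\<And>z. face (set z) \<Longrightarrow> length z = r \<Longrightarrow> d dvd f z" "r > 0"
    and "signlist p n x" "length x = r"
  shows "d dvd seval lab r x f"
proof (rule seval_dvd)
  fix ys assume ys: "length ys = r" "sorted_wrt (\<lambda>A B. B \<subseteq> A) ys"
    "\<And>A. A \<in> set ys \<Longrightarrow> A \<noteq> {} \<and> A \<subseteq> set x"
  have "face (set (map lab ys))"
    using ys assms(2,3) signlist_signset by (intro face_flag_labels) auto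
  then show "d dvd f (map lab ys)" using ys(1) by (intro assms(1)) auto
qed (rule assms(4))

text \<open>The value of \<open>f\<close> on the image of \<open>h\<^sub>i\<close> under subdivision
  and labelling; an \<open>i\<close>-simplex has \<open>Suc i\<close> vertices.\<close>

definition heval_lab :: "nat \<Rightarrow> ((nat \<times> nat) list \<Rightarrow> int) \<Rightarrow> int" where
  "heval_lab i f = heval p i (\<lambda>x. seval lab (Suc i) x f)"

lemma signlist_mono: "signlist p m x \<Longrightarrow> m \<le> n \<Longrightarrow> signlist p n x"
  by (fastforce simp: signlist_def)

lemma heval_lab_dvd:
  assumes "i < n" "\<And>z. face (set z) \<Longrightarrow> length z = Suc i \<Longrightarrow> d dvd f z"
  shows "d dvd heval_lab i f"
  unfolding heval_lab_def
proof (rule heval_dvd[OF p_pos])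
  fix x assume "signlist p (Suc i) x" "length x = Suc i"
  then show "d dvd seval lab (Suc i) x f"
    using assms signlist_mono[of "Suc i" x] by (intro seval_dvd_face) auto
qed

lemma heval_lab_diff: "heval_lab i (\<lambda>x. f x - g x) = heval_lab i f - heval_lab i g"
  unfolding heval_lab_def seval_diff by (rule heval_diff)

lemma heval_lab_cobd:
  assumes "Suc i < n"
  shows "heval_lab (Suc i) (cobd f) = heval_lab i (gop p i f)"
proof -
  have "heval_lab (Suc i) (cobd f) = heval p (Suc i) (cobd (\<lambda>y. seval lab (Suc i) y f))"
    unfolding heval_lab_def seval_cobd by (rule refl)
  also have "\<dots> = heval p i (gop p i (\<lambda>y. seval lab (Suc i) y f))"
    by (rule heval_cobd)
  finally have "heval_lab (Suc i) (cobd f) - heval_lab i (gop p i f) =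
      heval p i (\<lambda>x. gop p i (\<lambda>y. seval lab (Suc i) y f) x - seval lab (Suc i) x (gop p i f))"
    by (simp only: heval_diff heval_lab_def)
  \<comment> \<open>Divisibility by 0 is equality; in this form only the lists carrying
    \<open>h\<^sub>i\<close> matter, and \<open>seval_gop\<close> applies to them.\<close>
  moreover have "0 dvd \<dots>"
  proof (rule heval_dvd[OF p_pos])
    fix x assume "signlist p (Suc i) x" "length x = Suc i"
    then have "signlist p n x" "length x = Suc i"
      using assms signlist_mono[of "Suc i" x] by auto
    then show "0 dvd gop p i (\<lambda>y. seval lab (Suc i) y f) x - seval lab (Suc i) x (gop p i f)"
      by (simp only: seval_gop) simp
  qed
  ultimately show ?thesis by simp
qed

text \<open>\<open>f\<close> is \<open>\<theta>\<^sub>i\<close> and, in the induction step,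
  \<open>g\<close> is \<open>\<kappa>\<^sub>i\<close>. The cocycle condition is exact and on all
  lists, the kernel condition only mod \<open>p\<close> and on faces.\<close>

lemma cochain_exists:
  assumes "i < n"
  shows "\<exists>f. alternating f \<and> (\<forall>x. cobd f x = 0) \<and>
    (\<forall>x. face (set x) \<longrightarrow> length x = Suc i \<longrightarrow> int p dvd gop p (Suc i) f x) \<and>
    int p dvd heval_lab i f - 1"
  using assms
proof (induction i)
  case 0
  \<comment> \<open>\<open>cobd e\<close> is the augmentation, 1 on every vertex; its norm there is
    \<open>p\<close>, hence 0 mod \<open>p\<close>.\<close>
  define e :: "(nat \<times> nat) list \<Rightarrow> int" where "e = (\<lambda>x. if x = [] then 1 else 0)"
  have "alternating e" by (simp add: e_def alternating_def)
  then have "alternating (cobd e)" by (rule alternating_cobd)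
  moreover have single: "cobd e [v] = 1" for v by (simp add: e_def)
  moreover have "int p dvd gop p (Suc 0) (cobd e) x" if x: "length x = Suc 0" for x
  proof -
    obtain a b where "x = [(a, b)]" using x by (auto simp: length_Suc_conv)
    then have "gop p (Suc 0) (cobd e) x = int p"
      using single by (simp add: gop_def del: cobd.simps)
    then show ?thesis by simp
  qed
  moreover have "heval_lab 0 (cobd e) = 1"
    by (simp add: heval_lab_def e_def)
  ultimately show ?case by (intro exI[of _ "cobd e"]) (simp add: cobd_cobd del: cobd.simps)
next
  case (Suc i)
  then obtain f where f: "alternating f" "\<And>x. cobd f x = 0"
    "\<And>x. face (set x) \<Longrightarrow> length x = Suc i \<Longrightarrow> int p dvd gop p (Suc i) f x"
    "int p dvd heval_lab i f - 1"
    by auto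
  obtain g where g: "alternating g"
    "\<And>x. face (set x) \<Longrightarrow> length x = Suc i \<Longrightarrow> int p dvd gop p i g x - f x"
    using gop_exact[OF f(1,3)] by blast
  \<comment> \<open>By parity the operator is \<open>gop p i\<close>. It commutes with
    \<open>cobd\<close>, so the value is congruent to \<open>cobd f x = 0\<close>.\<close>
  have "int p dvd gop p (Suc (Suc i)) (cobd g) x"
    if x: "face (set x)" "length x = Suc (Suc i)" for x
  proof -
    have "int p dvd cobd (\<lambda>x. gop p i g x - f x) x"
    proof (rule cobd_dvd)
      fix y assume y: "subseq y x" "Suc (length y) = length x"
      then have "face (set y)"
        using x by (intro face_subset[OF x(1) subseq_set[OF y(1)]]) auto
      then show "int p dvd gop p i g y - f y" using x y by (intro g(2)) auto
    qed
    then show ?thesis by (simp add: cobd_diff f(2) cobd_gop) (simp add: gop_def)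
  qed
  \<comment> \<open>Stokes passes from \<open>cobd g\<close> to \<open>gop p i g\<close>, which
    agrees with \<open>f\<close> mod \<open>p\<close> on faces.\<close>
  moreover have "int p dvd heval_lab (Suc i) (cobd g) - 1"
  proof -
    have "int p dvd heval_lab i (\<lambda>x. gop p i g x - f x)"
      using Suc.prems g(2) by (intro heval_lab_dvd) auto
    then have "int p dvd heval_lab (Suc i) (cobd g) - heval_lab i f"
      using Suc.prems by (simp add: heval_lab_diff heval_lab_cobd)
    from dvd_add[OF this f(4)] show ?thesis by simp
  qed
  ultimately show ?case
    using alternating_cobd[OF g(1)] by (intro exI[of _ "cobd g"]) (simp add: cobd_cobd)
qed

text \<open>If all faces had fewer than \<open>n\<close> vertices, every list of \<open>n\<close>
  vertices from a face would have a repetition. The alternating cochain of top degree would vanish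
  there, although its value on the image chain is 1 mod \<open>p\<close>.\<close>

theorem Zp_Tucker: "n \<le> \<alpha> + t * (p - 1)"
proof (rule ccontr)
  assume less: "\<not> n \<le> \<alpha> + t * (p - 1)"
  then have n: "n - 1 < n" "Suc (n - 1) = n" by auto
  obtain f where f: "alternating f" "int p dvd heval_lab (n - 1) f - 1"
    using cochain_exists[OF n(1)] by blast
  have "int p dvd heval_lab (n - 1) f"
  proof (rule heval_lab_dvd[OF n(1)])
    fix z assume z: "face (set z)" "length z = Suc (n - 1)"
    then have "card (set z) < length z" using card_face[OF z(1)] less n by simp
    then have "\<not> distinct z" using distinct_card by fastforce
    then show "int p dvd f z" using alternating_not_distinct[OF f(1)] by simp
  qed
  with f(2) have "int p dvd 1" by (metis dvd_diff_right_iff)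
  then show False using prime_gt_1_nat[OF prime_p] by simp
qed

end

section \<open>Alternating subsequences and the labelling\<close>

lemma signset_finite: "signset p n X \<Longrightarrow> finite X"
  unfolding signset_def using finite_subset[of X "{1..n} \<times> {..<p}"] by simp

lemma signset_unique: "signset p n X \<Longrightarrow> (i, a) \<in> X \<Longrightarrow> (i, b) \<in> X \<Longrightarrow> a = b"
  unfolding signset_def using inj_onD[of fst X "(i, a)" "(i, b)"] by simp

lemma signset_subset: "signset p n X \<Longrightarrow> Y \<subseteq> X \<Longrightarrow> Y \<noteq> {} \<Longrightarrow> signset p n Y"
  unfolding signset_def using inj_on_subset[of fst X Y] by (simp add: subset_trans[of Y X])

lemma signset_pos: "signset p n X \<Longrightarrow> p > 0"
  by (cases p) (auto simp: signset_def)

lemma signset_rot: "signset p n X \<Longrightarrow> signset p n (rot p j ` X)"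
proof -
  assume X: "signset p n X"
  then have "p > 0" by (rule signset_pos)
  then have "rot p j ` X \<subseteq> {1..n} \<times> {..<p}"
    using X by (fastforce simp: signset_def)
  moreover have "inj_on fst (rot p j ` X)"
    using X by (auto simp: signset_def inj_on_def)
  ultimately show ?thesis using X by (simp add: signset_def)
qed

lemma rot_inverse: "signset p n X \<Longrightarrow> rot p (p - j mod p) ` rot p j ` X = X"
proof -
  assume X: "signset p n X"
  have "(j + (p - j mod p)) mod p = (j mod p + (p - j mod p)) mod p"
    by (simp add: mod_add_left_eq)
  also have "\<dots> = 0" using signset_pos[OF X] by (simp add: less_imp_le)
  finally have "rot p (j + (p - j mod p)) v = rot p 0 v" for v :: "nat \<times> nat"
    by (metis rot_mod)
  moreover have "rot p 0 v = v" if "v \<in> X" for v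
    using X that by (intro rot_0_id) (auto simp: signset_def)
  ultimately show ?thesis by (simp add: image_image)
qed

text \<open>Neighbours are taken within \<open>B\<close>, which makes \<open>B\<close> an
  alternating subsequence of any signed vector containing it.\<close>

definition zigzag :: "(nat \<times> nat) set \<Rightarrow> bool" where
  "zigzag B \<longleftrightarrow> (\<forall>i a j b. (i, a) \<in> B \<longrightarrow> (j, b) \<in> B \<longrightarrow> i < j \<longrightarrow>
     (\<forall>l. i < l \<longrightarrow> l < j \<longrightarrow> l \<notin> fst ` B) \<longrightarrow> a \<noteq> b)"

definition alt_num :: "(nat \<times> nat) set \<Rightarrow> nat" where
  "alt_num X = Max (card ` {B. B \<subseteq> X \<and> zigzag B})"

definition first_val :: "(nat \<times> nat) set \<Rightarrow> nat" where
  "first_val X = (THE a. (Min (fst ` X), a) \<in> X)"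

lemma alt_num_ge: "finite X \<Longrightarrow> B \<subseteq> X \<Longrightarrow> zigzag B \<Longrightarrow> card B \<le> alt_num X"
  unfolding alt_num_def by (intro Max_ge) auto

lemma alt_num_attained:
  assumes "finite X"
  obtains B where "B \<subseteq> X" "zigzag B" "card B = alt_num X"
proof -
  have "{} \<in> {B. B \<subseteq> X \<and> zigzag B}" by (simp add: zigzag_def)
  then have "alt_num X \<in> card ` {B. B \<subseteq> X \<and> zigzag B}"
    unfolding alt_num_def using assms by (intro Max_in) auto
  then show ?thesis using that by auto
qed

lemma alt_num_pos: "signset p n X \<Longrightarrow> alt_num X \<ge> 1"
proof -
  assume X: "signset p n X"
  then obtain v where "v \<in> X" by (auto simp: signset_def)
  then show ?thesis
    using alt_num_ge[OF signset_finite[OF X], of "{v}"] by (cases v) (auto simp: zigzag_def)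
qed

lemma first_val:
  assumes "signset p n X"
  shows "(Min (fst ` X), first_val X) \<in> X"
proof -
  have "Min (fst ` X) \<in> fst ` X"
    using assms signset_finite[OF assms] by (intro Min_in) (auto simp: signset_def)
  then obtain a where a: "(Min (fst ` X), a) \<in> X" by auto
  then show ?thesis unfolding first_val_def by (rule theI) (rule signset_unique[OF assms _ a])
qed

text \<open>Otherwise the first entry of \<open>Y\<close> could be put in front of \<open>B\<close>,
  giving a longer alternating subsequence.\<close>

lemma first_val_zigzag:
  assumes Y: "signset p n Y" and B: "B \<subseteq> Y" "zigzag B" "B \<noteq> {}" "card B = alt_num Y"
  shows "first_val B = first_val Y"
proof (rule ccontr)
  assume neq: "first_val B \<noteq> first_val Y"
  define i where "i = Min (fst ` Y)"
  define m where "m = Min (fst ` B)"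
  have sB: "signset p n B" by (rule signset_subset[OF Y B(1,3)])
  note finB = signset_finite[OF sB] and finY = signset_finite[OF Y]
  have iY: "(i, first_val Y) \<in> Y" unfolding i_def by (rule first_val[OF Y])
  have mB: "(m, first_val B) \<in> B" unfolding m_def by (rule first_val[OF sB])
  have le: "i \<le> j" if "(j, b) \<in> Y" for j b
    unfolding i_def using finY that by (intro Min_le) force+
  have leB: "m \<le> j" if "(j, b) \<in> B" for j b
    unfolding m_def using finB that by (intro Min_le) force+
  have mY: "(m, first_val B) \<in> Y" using mB B(1) by (rule subsetD[rotated])
  have "i \<noteq> m"
  proof
    assume "i = m"
    then show False using signset_unique[OF Y iY, of "first_val B"] mY neq by simp
  qed
  then have im: "i < m" using le[OF mY] by simp
  let ?B = "insert (i, first_val Y) B"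
  have "zigzag ?B"
    unfolding zigzag_def
  proof (intro allI impI)
    fix j a l b
    assume ja: "(j, a) \<in> ?B" and lb: "(l, b) \<in> ?B" and jl: "j < l"
      and between: "\<forall>q. j < q \<longrightarrow> q < l \<longrightarrow> q \<notin> fst ` ?B"
    have "(j, a) \<in> Y" using ja iY B(1) by auto
    then have "i \<le> j" by (rule le)
    then have "l \<noteq> i" using jl by simp
    then have lB: "(l, b) \<in> B" using lb by auto
    show "a \<noteq> b"
    proof (cases "(j, a) \<in> B")
      case True
      moreover have "\<forall>q. j < q \<longrightarrow> q < l \<longrightarrow> q \<notin> fst ` B" using between by blast
      ultimately show ?thesis
        using B(2) lB jl unfolding zigzag_def by blast
    next
      case False
      then have j: "j = i" "a = first_val Y" using ja by auto
      have "m \<in> fst ` ?B" using mB by (intro image_eqI[of _ _ "(m, first_val B)"]) auto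
      then have "\<not> m < l" using between im j(1) by blast
      then have "m = l" using leB[OF lB] by simp
      then have "b = first_val B" using signset_unique[OF sB mB, of b] lB by simp
      then show ?thesis using j(2) neq by simp
    qed
  qed
  moreover have "(i, first_val Y) \<notin> B" using leB im by fastforce
  ultimately show False
    using alt_num_ge[OF finY, of ?B] iY B finB by simp
qed

text \<open>A longest alternating subsequence of \<open>X\<close> is also a longest one of
  \<open>Y\<close>, and its first value is that of both.\<close>

lemma first_val_eq:
  assumes "signset p n X" "signset p n Y" "X \<subseteq> Y" "alt_num X = alt_num Y"
  shows "first_val X = first_val Y"
proof -
  obtain B where B: "B \<subseteq> X" "zigzag B" "card B = alt_num X"
    using alt_num_attained[OF signset_finite[OF assms(1)]] .
  then have "B \<noteq> {}" using alt_num_pos[OF assms(1)] by auto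
  then show ?thesis
    using first_val_zigzag[OF assms(1) B(1,2)] first_val_zigzag[OF assms(2) _ B(2)] B assms by auto
qed

lemma zigzag_rot:
  assumes "signset p n B" "zigzag B"
  shows "zigzag (rot p j ` B)"
  unfolding zigzag_def
proof (intro allI impI)
  fix i a l b
  assume "(i, a) \<in> rot p j ` B" "(l, b) \<in> rot p j ` B" and il: "i < l"
    and between: "\<forall>q. i < q \<longrightarrow> q < l \<longrightarrow> q \<notin> fst ` rot p j ` B"
  then obtain a' b' where ab: "(i, a') \<in> B" "a = (a' + j) mod p" "(l, b') \<in> B" "b = (b' + j) mod p"
    by auto
  have "fst ` rot p j ` B = fst ` B" by (simp add: image_image)
  then have "a' \<noteq> b'" using assms(2) ab il between unfolding zigzag_def by blast
  then show "a \<noteq> b"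
    using ab assms(1) inj_on_eq_iff[OF inj_on_shift[of j p], of a' b'] by (auto simp: signset_def)
qed

lemma inj_on_rot: "signset p n X \<Longrightarrow> inj_on (rot p j) X"
  unfolding signset_def by (intro inj_onI) (metis fst_rot inj_onD)

lemma alt_num_rot_le:
  assumes "signset p n X"
  shows "alt_num X \<le> alt_num (rot p j ` X)"
proof -
  obtain B where B: "B \<subseteq> X" "zigzag B" "card B = alt_num X"
    using alt_num_attained[OF signset_finite[OF assms]] .
  then have "B \<noteq> {}" using alt_num_pos[OF assms] by auto
  then have sB: "signset p n B" using signset_subset[OF assms B(1)] by simp
  have "card (rot p j ` B) \<le> alt_num (rot p j ` X)"
    using B(1) signset_finite[OF assms] zigzag_rot[OF sB B(2)] by (intro alt_num_ge) auto
  then show ?thesis using B(3) card_image[OF inj_on_rot[OF sB, of j]] by simp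
qed

lemma alt_num_rot:
  assumes "signset p n X"
  shows "alt_num (rot p j ` X) = alt_num X"
  using alt_num_rot_le[OF assms, of j] alt_num_rot_le[OF signset_rot[OF assms, of j], of "p - j mod p"]
  by (simp add: rot_inverse[OF assms])

lemma first_val_rot:
  assumes "signset p n X"
  shows "first_val (rot p j ` X) = (first_val X + j) mod p"
proof -
  have "fst ` rot p j ` X = fst ` X" by (simp add: image_image)
  then have "(Min (fst ` X), first_val (rot p j ` X)) \<in> rot p j ` X"
    using first_val[OF signset_rot[OF assms, of j]] by simp
  moreover have "(Min (fst ` X), (first_val X + j) mod p) \<in> rot p j ` X"
    using imageI[OF first_val[OF assms], of "rot p j"] by simp
  ultimately show ?thesis using signset_unique[OF signset_rot[OF assms]] by blast
qed

section \<open>Stable sets on which a signed vector is constant\<close>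

definition stable_in :: "nat \<Rightarrow> nat \<Rightarrow> nat \<Rightarrow> (nat \<times> nat) set \<Rightarrow> nat set set" where
  "stable_in p n k X = {S \<in> almost_stable_sets n k 2. \<exists>a<p. S \<times> {a} \<subseteq> X}"

lemma stable_in_rot_subset:
  assumes "signset p n X"
  shows "stable_in p n k X \<subseteq> stable_in p n k (rot p j ` X)"
proof
  fix S assume "S \<in> stable_in p n k X"
  then obtain a where S: "S \<in> almost_stable_sets n k 2" "S \<times> {a} \<subseteq> X"
    by (auto simp: stable_in_def)
  then have "S \<times> {(a + j) mod p} \<subseteq> rot p j ` X" by force
  moreover have "(a + j) mod p < p" using signset_pos[OF assms] by simp
  ultimately show "S \<in> stable_in p n k (rot p j ` X)" using S by (auto simp: stable_in_def)
qed

lemma stable_in_rot: "signset p n X \<Longrightarrow> stable_in p n k (rot p j ` X) = stable_in p n k X"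
  using stable_in_rot_subset[of p n X k j]
    stable_in_rot_subset[of p n "rot p j ` X" k "p - j mod p"]
  by (simp add: rot_inverse[of p n X] signset_rot)

text \<open>By pigeonhole some value occurs \<open>k\<close> times in a longest alternating
  subsequence. Adjacent positions would be neighbours there, so equal values are at least 2
  apart.\<close>

lemma stable_in_nonempty:
  assumes X: "signset p n X" and k: "k \<ge> 1" and alt: "alt_num X > p * (k - 1)"
  shows "stable_in p n k X \<noteq> {}"
proof -
  obtain B where B: "B \<subseteq> X" "zigzag B" "card B = alt_num X"
    using alt_num_attained[OF signset_finite[OF X]] .
  have finB: "finite B" using B(1) signset_finite[OF X] finite_subset by blast
  define P where "P = (\<lambda>a. {i. (i, a) \<in> B})"
  have finP: "finite (P a)" for a
    using finite_subset[of "P a" "fst ` B"] finB by (force simp: P_def)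
  have "\<exists>a<p. card (P a) \<ge> k"
  proof (rule ccontr)
    assume "\<not> ?thesis"
    then have small: "card (P a) \<le> k - 1" if "a < p" for a using that by fastforce
    have "B = (\<Union>a<p. (\<lambda>i. (i, a)) ` P a)"
      using B(1) X by (fastforce simp: P_def signset_def)
    then have "card B \<le> (\<Sum>a<p. card ((\<lambda>i. (i, a)) ` P a))"
      using card_UN_le[of "{..<p}" "\<lambda>a. (\<lambda>i. (i, a)) ` P a"] by simp
    also have "\<dots> \<le> (\<Sum>a<p. k - 1)"
      using small by (intro sum_mono order_trans[OF card_image_le[OF finP]]) simp
    finally show False using alt B(3) by simp
  qed
  then obtain a where a: "a < p" "card (P a) \<ge> k" by blast
  then obtain S where S: "S \<subseteq> P a" "card S = k" by (meson obtain_subset_with_card_n)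
  have gap: "Suc i < j" if "i \<in> P a" "j \<in> P a" "i < j" for i j
  proof (rule ccontr)
    assume "\<not> Suc i < j"
    then have "j = Suc i" using that by simp
    then have "(i, a) \<in> B" "(Suc i, a) \<in> B" using that by (simp_all add: P_def)
    moreover have "\<forall>l. i < l \<longrightarrow> l < Suc i \<longrightarrow> l \<notin> fst ` B" by simp
    ultimately show False using B(2) unfolding zigzag_def by blast
  qed
  have "\<bar>int i - int j\<bar> \<ge> int 2" if "i \<in> S" "j \<in> S" "i \<noteq> j" for i j
    using gap[of i j] gap[of j i] that S(1) by (cases i j rule: linorder_cases) force+
  moreover have "S \<times> {a} \<subseteq> X" using S(1) B(1) by (auto simp: P_def)
  moreover have "S \<subseteq> {1..n}"
    using \<open>S \<times> {a} \<subseteq> X\<close> X by (auto simp: signset_def)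
  ultimately have "S \<in> stable_in p n k X"
    using S(2) a(1) by (auto simp: stable_in_def almost_stable_sets_def)
  then show ?thesis by blast
qed

text \<open>The choice depends on \<open>X\<close> only through \<open>stable_in\<close>, which is
  invariant under rotation; hence \<open>rot\<close> keeps the chosen set and moves only its
  value.\<close>

definition chosen :: "nat \<Rightarrow> nat \<Rightarrow> nat \<Rightarrow> (nat \<times> nat) set \<Rightarrow> nat set" where
  "chosen p n k X = (SOME S. S \<in> stable_in p n k X)"

definition chosen_val :: "nat \<Rightarrow> nat \<Rightarrow> nat \<Rightarrow> (nat \<times> nat) set \<Rightarrow> nat" where
  "chosen_val p n k X = (THE a. chosen p n k X \<times> {a} \<subseteq> X)"

lemma chosen:
  assumes "signset p n X" "k \<ge> 1" "alt_num X > p * (k - 1)"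
  shows "chosen p n k X \<in> almost_stable_sets n k 2" "chosen_val p n k X < p"
    "chosen p n k X \<times> {chosen_val p n k X} \<subseteq> X"
    "\<And>b. chosen p n k X \<times> {b} \<subseteq> X \<Longrightarrow> b = chosen_val p n k X"
proof -
  have "chosen p n k X \<in> stable_in p n k X"
    unfolding chosen_def using stable_in_nonempty[OF assms] by (rule some_in_eq[THEN iffD2])
  then obtain a where S: "chosen p n k X \<in> almost_stable_sets n k 2"
    and a: "a < p" "chosen p n k X \<times> {a} \<subseteq> X"
    by (auto simp: stable_in_def)
  show "chosen p n k X \<in> almost_stable_sets n k 2" by (rule S)
  have "chosen p n k X \<noteq> {}" using S assms(2) by (auto simp: almost_stable_sets_def)
  then obtain i where i: "i \<in> chosen p n k X" by blast
  have uniq: "b = a" if "chosen p n k X \<times> {b} \<subseteq> X" for b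
    using signset_unique[OF assms(1), of i b a] a(2) that i by blast
  have val: "chosen_val p n k X = a"
    unfolding chosen_val_def by (rule the_equality) (fact a(2), rule uniq)
  show "chosen_val p n k X < p" "chosen p n k X \<times> {chosen_val p n k X} \<subseteq> X"
    unfolding val by (fact a)+
  show "\<And>b. chosen p n k X \<times> {b} \<subseteq> X \<Longrightarrow> b = chosen_val p n k X"
    unfolding val by (rule uniq)
qed

lemma chosen_rot:
  assumes "signset p n X" "k \<ge> 1" "alt_num X > p * (k - 1)"
  shows "chosen p n k (rot p j ` X) = chosen p n k X"
    "chosen_val p n k (rot p j ` X) = (chosen_val p n k X + j) mod p"
proof -
  show eq: "chosen p n k (rot p j ` X) = chosen p n k X"
    by (simp add: chosen_def stable_in_rot[OF assms(1)])
  have "chosen p n k X \<times> {(chosen_val p n k X + j) mod p} \<subseteq> rot p j ` X"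
    using chosen(3)[OF assms] by force
  then have "(chosen_val p n k X + j) mod p = chosen_val p n k (rot p j ` X)"
    using assms by (intro chosen(4)) (simp_all add: signset_rot alt_num_rot eq)
  then show "chosen_val p n k (rot p j ` X) = (chosen_val p n k X + j) mod p" by simp
qed

text \<open>Levels start at 0, lengths and colors at 1. Lengths up to \<open>p * (k - 1)\<close> go
  to the low levels, color \<open>q\<close> to level \<open>p * (k - 1) + q - 1\<close>.\<close>

definition label :: "nat \<Rightarrow> nat \<Rightarrow> nat \<Rightarrow> (nat set \<Rightarrow> nat) \<Rightarrow> (nat \<times> nat) set \<Rightarrow> nat \<times> nat" where
  "label p n k c X = (if alt_num X \<le> p * (k - 1) then (alt_num X - 1, first_val X)
     else (p * (k - 1) + c (chosen p n k X) - 1, chosen_val p n k X))"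

section \<open>The bound for proper colorings\<close>

lemma proper_coloring_bound:
  assumes p: "prime p" and k: "k \<ge> 1"
    and c: "proper_coloring (almost_stable_kneser_hypergraph p n k 2) t c"
  shows "n \<le> p * (k - 1) + t * (p - 1)"
proof -
  let ?\<alpha> = "p * (k - 1)" and ?lab = "label p n k c"
  have color: "c S \<ge> 1 \<and> c S \<le> t" if "S \<in> almost_stable_sets n k 2" for S
    using c that by (auto simp: proper_coloring_def almost_stable_kneser_hypergraph_def Pi_iff)
  \<comment> \<open>Colors are at least 1, so subtracting 1 does not push a color label down to a
    low level.\<close>
  have low: "alt_num X \<le> ?\<alpha> \<longleftrightarrow> fst (?lab X) < ?\<alpha>" if X: "signset p n X" for X
  proof (cases "alt_num X \<le> ?\<alpha>")
    case False
    then have "fst (?lab X) = ?\<alpha> + c (chosen p n k X) - 1" by (simp add: label_def)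
    moreover have "c (chosen p n k X) \<ge> 1"
      using False color[OF chosen(1)[OF X k]] by simp
    ultimately show ?thesis using False by linarith
  qed (use alt_num_pos[OF X] in \<open>simp add: label_def\<close>)
  interpret tucker_labelling p n ?\<alpha> t ?lab
  proof
    show "prime p" by (rule p)
  next
    fix X assume X: "signset p n X"
    show "?lab X \<in> {..<?\<alpha> + t} \<times> {..<p}"
    proof (cases "alt_num X \<le> ?\<alpha>")
      case True
      have "first_val X < p" using first_val[OF X] X by (auto simp: signset_def)
      then show ?thesis using True alt_num_pos[OF X] by (simp add: label_def)
    next
      case False
      then have "?lab X = (?\<alpha> + c (chosen p n k X) - 1, chosen_val p n k X)"
        by (simp add: label_def)
      moreover have "1 \<le> c (chosen p n k X)" "c (chosen p n k X) \<le> t"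
        using False color[OF chosen(1)[OF X k]] by simp_all
      then have "?\<alpha> + c (chosen p n k X) - 1 < ?\<alpha> + t" by linarith
      moreover have "chosen_val p n k X < p" using False chosen(2)[OF X k] by simp
      ultimately show ?thesis by simp
    qed
    fix j
    show "?lab (rot p j ` X) = rot p j (?lab X)"
      using chosen_rot[OF X k] by (simp add: label_def alt_num_rot[OF X] first_val_rot[OF X])
  next
    fix X Y assume X: "signset p n X" and Y: "signset p n Y" and XY: "X \<subseteq> Y"
      and eq: "fst (?lab X) = fst (?lab Y)" "fst (?lab X) < ?\<alpha>"
    then have "alt_num X \<le> ?\<alpha>" "alt_num Y \<le> ?\<alpha>" using low by auto
    moreover from this have "alt_num X = alt_num Y"
      using eq(1) alt_num_pos[OF X] alt_num_pos[OF Y] by (simp add: label_def)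
    ultimately show "?lab X = ?lab Y"
      using first_val_eq[OF X Y XY] by (simp add: label_def)
  next
    fix C l
    assume sC: "\<And>A. A \<in> C \<Longrightarrow> signset p n A"
      and chain: "\<And>A B. A \<in> C \<Longrightarrow> B \<in> C \<Longrightarrow> A \<subseteq> B \<or> B \<subseteq> A" and l: "l \<ge> ?\<alpha>"
    \<comment> \<open>If a chain had all \<open>p\<close> values at level \<open>l\<close>, its
      chosen sets would be \<open>p\<close> pairwise disjoint sets of the same color, a
      monochromatic edge.\<close>
    show "\<exists>a<p. (l, a) \<notin> ?lab ` C"
    proof (rule ccontr)
      assume "\<not> ?thesis"
      then have "\<forall>a<p. \<exists>A\<in>C. ?lab A = (l, a)" by (force simp: image_iff)
      then obtain A where A: "\<And>a. a < p \<Longrightarrow> A a \<in> C \<and> ?lab (A a) = (l, a)" by metis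
      define S where "S = (\<lambda>a. chosen p n k (A a))"
      have S: "S a \<in> almost_stable_sets n k 2 \<and> S a \<times> {a} \<subseteq> A a \<and> c (S a) = Suc l - ?\<alpha>"
        if a: "a < p" for a
      proof -
        have sA: "signset p n (A a)" using A[OF a] sC by blast
        have alt: "alt_num (A a) > ?\<alpha>" using low[OF sA] A[OF a] l by simp
        note ch = chosen[OF sA k alt]
        have "chosen_val p n k (A a) = a" "?\<alpha> + c (S a) - 1 = l"
          using A[OF a] alt by (auto simp: label_def S_def)
        moreover have "c (S a) \<ge> 1" using color[OF ch(1)] by (simp add: S_def)
        ultimately have "c (S a) = Suc l - ?\<alpha>" by linarith
        moreover have "S a \<times> {a} \<subseteq> A a"
          using ch(3) \<open>chosen_val p n k (A a) = a\<close> by (simp add: S_def)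
        ultimately show ?thesis using ch(1) by (simp add: S_def)
      qed
      \<comment> \<open>The larger of the two comparable signed vectors would have two values at a
        common position.\<close>
      have disj: "S a \<inter> S b = {}" if ab: "a < p" "b < p" "a \<noteq> b" for a b
      proof (rule ccontr)
        assume "S a \<inter> S b \<noteq> {}"
        then obtain i where "i \<in> S a" "i \<in> S b" by blast
        then have i: "(i, a) \<in> A a" "(i, b) \<in> A b" using S[OF ab(1)] S[OF ab(2)] by auto
        have AC: "A a \<in> C" "A b \<in> C" using A ab by simp_all
        from chain[OF AC] have "a = b"
        proof
          assume "A a \<subseteq> A b"
          then show ?thesis using signset_unique[OF sC[OF AC(2)]] i by blast
        next
          assume "A b \<subseteq> A a"
          then show ?thesis using signset_unique[OF sC[OF AC(1)]] i by blast
        qed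
        then show False using ab(3) by simp
      qed
      have nonempty: "S a \<noteq> {}" if "a < p" for a
        using S[OF that] k by (auto simp: almost_stable_sets_def)
      have "inj_on S {..<p}"
      proof (rule inj_onI, rule ccontr)
        fix a b assume "a \<in> {..<p}" "b \<in> {..<p}" "S a = S b" "a \<noteq> b"
        then show False using disj[of a b] nonempty[of a] by simp
      qed
      then have "card (S ` {..<p}) = p" by (simp add: card_image)
      moreover have "disjoint (S ` {..<p})"
        using disj by (auto simp: disjoint_def)
      ultimately have "S ` {..<p} \<in> edges (almost_stable_kneser_hypergraph p n k 2)"
        using S by (auto simp: almost_stable_kneser_hypergraph_def)
      then have "\<not> monochromatic c (S ` {..<p})"
        using c by (simp add: proper_coloring_def)
      then show False using S by (auto simp: monochromatic_def)
    qed
  qed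
  show ?thesis by (rule Zp_Tucker)
qed

theorem theorem1:
  fixes p n k :: nat
  assumes "prime p" and "k \<ge> 1" and "n \<ge> p * k"
  shows "int (chromatic_number (almost_stable_kneser_hypergraph p n k 2))
    \<ge> \<lceil>(real n - (real k - 1) * real p) / (real p - 1)\<rceil>"
proof -
  let ?H = "almost_stable_kneser_hypergraph p n k 2"
  define t where "t = chromatic_number ?H"
  have p: "p \<ge> 2" using assms(1) by (rule prime_ge_2_nat)
  \<comment> \<open>This makes the \<open>LEAST\<close> in \<open>chromatic_number\<close> an
    attained value.\<close>
  have "\<exists>t c. proper_coloring ?H t c" using p by (rule proper_coloring_exists)
  then have "\<exists>c. proper_coloring ?H t c"
    unfolding t_def chromatic_number_def by (rule LeastI_ex)
  then have "n \<le> p * (k - 1) + t * (p - 1)"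
    using proper_coloring_bound[OF assms(1,2)] by blast
  then have "real n \<le> real (p * (k - 1) + t * (p - 1))" by (rule of_nat_mono)
  also have "\<dots> = real p * (real k - 1) + real t * (real p - 1)"
    using assms(2) p by (simp add: of_nat_diff)
  finally have "(real n - (real k - 1) * real p) / (real p - 1) \<le> real t"
    using p by (simp add: divide_le_eq algebra_simps)
  then show ?thesis unfolding t_def by (simp add: ceiling_le_iff)
qed

end
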